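(* Let $X,Y$ be locally convex Hausdorff topological vector spaces. If $F_1,F_2\colon X\rightrightarrows Y$ are polyhedral convex multifunctions, then the multifunction $F_1+F_2\colon X\rightrightarrows Y$ is also polyhedral convex.
   Context: All vector spaces are real. A subset $D$ of a locally convex Hausdorff topological vector space $E$ is a polyhedral convex set if there exist finitely many continuous linear functionals $e_i^*\in E^*$ and $\alpha_i\in\mathbb{R}$, $i=1,\dots,m$, with $D=\{e\in E\mid \langle e_i^*,e\rangle\le\alpha_i,\ i=1,\dots,m\}$. The empty set counts as polyhedral convex. A multifunction $F\colon X\rightrightarrows Y$ assigns to each $x\in X$ a (possibly empty) subset $F(x)\subset Y$; $\mathrm{gph}\,F=\{(x,y)\in X\times Y\mid y\in F(x)\}$. $F$ is polyhedral convex if $\mathrm{gph}\,F$ is a polyhedral convex set in $X\times Y$. The sum is $(F_1+F_2)(x)=F_1(x)+F_2(x)=\{y_1+y_2\mid y_1\in F_1(x),\ y_2\in F_2(x)\}$ (empty if either value is empty). *)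

theory Defs
  imports "HOL-Analysis.Analysis" "HOL-Library.Set_Algebras"
begin

class real_topological_vector_space = real_vector + topological_ab_group_add +
  assumes tendsto_scaleR_nhds_pair:
    "LIM p (nhds c \<times>\<^sub>F nhds x). fst p *\<^sub>R snd p :> nhds (c *\<^sub>R x)"

text \<open>The constant \<^const>\<open>convex\<close> cannot be used inside the class specification, so its
  definition is written out there.\<close>

class locally_convex_hausdorff_space = real_topological_vector_space + t2_space +
  assumes convex_neighbourhood_base:
    "open U \<Longrightarrow> 0 \<in> U \<Longrightarrow> \<exists>V. open V \<and> 0 \<in> V \<and> V \<subseteq> U \<and>
      (\<forall>x\<in>V. \<forall>y\<in>V. \<forall>u\<ge>0. \<forall>v\<ge>0. u + v = 1 \<longrightarrow> u *\<^sub>R x + v *\<^sub>R y \<in> V)"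

lemma convex_neighbourhood:
  fixes U :: "'a::locally_convex_hausdorff_space set"
  assumes "open U" "0 \<in> U"
  shows "\<exists>V. open V \<and> 0 \<in> V \<and> V \<subseteq> U \<and> convex V"
  unfolding convex_def using assms by (rule convex_neighbourhood_base)

lemma continuous_scaleR_pair:
  "continuous_on UNIV (\<lambda>p::real \<times> 'a::real_topological_vector_space. fst p *\<^sub>R snd p)"
proof -
  have "((\<lambda>p. fst p *\<^sub>R snd p) \<longlongrightarrow> fst q *\<^sub>R snd q) (nhds q)" for q :: "real \<times> 'a"
    using tendsto_scaleR_nhds_pair[of "fst q" "snd q"] by (simp add: nhds_prod[symmetric])
  then show ?thesis
    unfolding continuous_on_def by (auto intro: tendsto_mono[OF at_within_le_nhds])
qed

instance real_normed_vector \<subseteq> locally_convex_hausdorff_space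
proof
  fix c :: real and x :: 'a
  have "(fst \<longlongrightarrow> c) (nhds c \<times>\<^sub>F nhds x)" "(snd \<longlongrightarrow> x) (nhds c \<times>\<^sub>F nhds x)"
    by (rule filterlim_fst filterlim_snd)+
  then show "LIM p (nhds c \<times>\<^sub>F nhds x). fst p *\<^sub>R snd p :> nhds (c *\<^sub>R x)"
    by (rule tendsto_scaleR)
next
  fix U :: "'a set"
  assume "open U" "0 \<in> U"
  then obtain e where "e > 0" "ball 0 e \<subseteq> U"
    by (meson openE)
  then show "\<exists>V. open V \<and> 0 \<in> V \<and> V \<subseteq> U \<and>
      (\<forall>x\<in>V. \<forall>y\<in>V. \<forall>u\<ge>0. \<forall>v\<ge>0. u + v = 1 \<longrightarrow> u *\<^sub>R x + v *\<^sub>R y \<in> V)"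
    unfolding convex_def[symmetric] by (intro exI[of _ "ball 0 e"]) auto
qed

text \<open>The product \<open>X \<times> Y\<close> with the product topology is again a locally convex Hausdorff space.\<close>

instance prod :: (topological_monoid_add, topological_monoid_add) topological_monoid_add
proof
  fix a b :: "'a \<times> 'b"
  let ?F = "nhds a \<times>\<^sub>F nhds b"
  have "(fst \<longlongrightarrow> a) ?F" "(snd \<longlongrightarrow> b) ?F"
    by (rule filterlim_fst filterlim_snd)+
  then have "((\<lambda>p. (fst (fst p) + fst (snd p), snd (fst p) + snd (snd p)))
      \<longlongrightarrow> (fst a + fst b, snd a + snd b)) ?F"
    by (intro tendsto_intros)
  then show "LIM p ?F. fst p + snd p :> nhds (a + b)"
    by (simp add: plus_prod_def)
qed

instance prod :: (topological_group_add, topological_group_add) topological_group_add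
proof
  fix a :: "'a \<times> 'b"
  have "((\<lambda>p. (- fst p, - snd p)) \<longlongrightarrow> (- fst a, - snd a)) (nhds a)"
    by (intro tendsto_intros filterlim_ident)
  then show "(uminus \<longlongrightarrow> - a) (nhds a)"
    unfolding uminus_prod_def[abs_def] by simp
qed

instance prod :: (topological_ab_group_add, topological_ab_group_add) topological_ab_group_add ..

instance prod :: (real_topological_vector_space, real_topological_vector_space)
  real_topological_vector_space
proof
  fix c :: real and x :: "'a \<times> 'b"
  let ?F = "nhds c \<times>\<^sub>F nhds x"
  have lim: "(fst \<longlongrightarrow> c) ?F" "(snd \<longlongrightarrow> x) ?F"
    by (rule filterlim_fst filterlim_snd)+
  have 1: "((\<lambda>p. fst p *\<^sub>R fst (snd p)) \<longlongrightarrow> c *\<^sub>R fst x) ?F"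
    using filterlim_compose[OF tendsto_scaleR_nhds_pair
        filterlim_Pair[OF lim(1) tendsto_fst[OF lim(2)]]] by simp
  have 2: "((\<lambda>p. fst p *\<^sub>R snd (snd p)) \<longlongrightarrow> c *\<^sub>R snd x) ?F"
    using filterlim_compose[OF tendsto_scaleR_nhds_pair
        filterlim_Pair[OF lim(1) tendsto_snd[OF lim(2)]]] by simp
  show "LIM p ?F. fst p *\<^sub>R snd p :> nhds (c *\<^sub>R x)"
    unfolding scaleR_prod_def by (intro tendsto_Pair 1 2)
qed

instance prod :: (locally_convex_hausdorff_space, locally_convex_hausdorff_space)
  locally_convex_hausdorff_space
proof
  fix U :: "('a \<times> 'b) set"
  assume "open U" "0 \<in> U"
  then obtain A B where AB: "open A" "open B" "0 \<in> A" "0 \<in> B" "A \<times> B \<subseteq> U"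
    unfolding zero_prod_def by (auto elim: open_prod_elim)
  obtain V where V: "open V" "0 \<in> V" "convex V" "V \<subseteq> A"
    using convex_neighbourhood AB by blast
  obtain W where W: "open W" "0 \<in> W" "convex W" "W \<subseteq> B"
    using convex_neighbourhood AB by blast
  show "\<exists>V. open V \<and> 0 \<in> V \<and> V \<subseteq> U \<and>
      (\<forall>x\<in>V. \<forall>y\<in>V. \<forall>u\<ge>0. \<forall>v\<ge>0. u + v = 1 \<longrightarrow> u *\<^sub>R x + v *\<^sub>R y \<in> V)"
    unfolding convex_def[symmetric] using V W AB
    by (intro exI[of _ "V \<times> W"]) (auto simp: open_Times convex_Times zero_prod_def)
qed

definition continuous_dual :: "('a::real_topological_vector_space \<Rightarrow> real) set" where
  "continuous_dual = {f. linear f \<and> continuous_on UNIV f}"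

definition polyhedral_convex_set :: "'a::locally_convex_hausdorff_space set \<Rightarrow> bool" where
  "polyhedral_convex_set D \<longleftrightarrow>
    (\<exists>(m::nat) (e :: nat \<Rightarrow> 'a \<Rightarrow> real) (\<alpha> :: nat \<Rightarrow> real).
      (\<forall>i\<in>{1..m}. e i \<in> continuous_dual) \<and>
      D = {x. \<forall>i\<in>{1..m}. e i x \<le> \<alpha> i})"

text \<open>The convention that the empty set is polyhedral convex needs no separate clause:
  the zero functional is allowed.\<close>

lemma polyhedral_convex_set_empty:
  "polyhedral_convex_set ({} :: 'a::locally_convex_hausdorff_space set)"
  unfolding polyhedral_convex_set_def
  by (rule exI[of _ 1], rule exI[of _ "\<lambda>_ _. 0"], rule exI[of _ "\<lambda>_. -1"])
    (auto simp: continuous_dual_def linear_iff)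

definition gph :: "('x \<Rightarrow> 'y set) \<Rightarrow> ('x \<times> 'y) set" where
  "gph F = {(x, y). y \<in> F x}"

definition polyhedral_convex_multifunction ::
  "('x::locally_convex_hausdorff_space \<Rightarrow> 'y::locally_convex_hausdorff_space set) \<Rightarrow> bool" where
  "polyhedral_convex_multifunction F \<longleftrightarrow> polyhedral_convex_set (gph F)"

text \<open>Below, \<open>+\<close> on sets is the elementwise sum of \<^theory>\<open>HOL-Library.Set_Algebras\<close>.\<close>

definition multifunction_sum :: "('x \<Rightarrow> 'y::plus set) \<Rightarrow> ('x \<Rightarrow> 'y set) \<Rightarrow> 'x \<Rightarrow> 'y set" where
  "multifunction_sum F1 F2 = (\<lambda>x. F1 x + F2 x)"

end

theory Submission
  imports Defs
begin

text \<open>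
  The graph of \<open>F\<^sub>1 + F\<^sub>2\<close> is the image, under the projection that forgets \<open>z\<close>, of the set
  \<open>P\<close> of all \<open>((x, y), z)\<close> with \<open>z \<in> F\<^sub>1 x\<close> and \<open>y - z \<in> F\<^sub>2 x\<close>.  Polyhedral convexity is preserved
  by intersections and by preimages under continuous linear maps, so \<open>P\<close> is polyhedral convex
  in \<open>(X \<times> Y) \<times> Y\<close>.  A point \<open>p\<close> lies in the projection of \<open>P\<close> if and only if \<open>(p, 0)\<close> lies
  in \<open>P + W\<close>, where \<open>W\<close> is the subspace \<open>{0} \<times> Y\<close>.  The theorem therefore
  reduces to the fact that \<open>P + W\<close> is polyhedral convex for every linear subspace \<open>W\<close>
  (\<open>polyhedral_convex_set_plus_subspace\<close>).

  The subspace may have infinite dimension.  This is harmless because \<open>P\<close> is described by finitely many functionals, and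
  \<open>P + N = P\<close> for the part \<open>N\<close> of \<open>W\<close> on which all of them vanish.  Since \<open>N\<close> has finite codimension
  in \<open>W\<close>, only finitely many directions have to be added to \<open>N\<close>, and a single direction is
  handled by Fourier--Motzkin elimination (\<open>polyhedral_convex_set_plus_line\<close>).
\<close>

section \<open>Finite systems of linear inequalities\<close>

text \<open>Describing polyhedral convex sets by a finite set of pairs \<open>(f, a)\<close>, each standing for the
  inequality \<open>f x \<le> a\<close>, makes it possible to combine systems by unions and images
  without renumbering.\<close>

definition solution_set :: "(('a \<Rightarrow> real) \<times> real) set \<Rightarrow> 'a set" where
  "solution_set H = {x. \<forall>(f, a)\<in>H. f x \<le> a}"

lemma mem_solution_set: "x \<in> solution_set H \<longleftrightarrow> (\<forall>(f, a)\<in>H. f x \<le> a)"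
  by (simp add: solution_set_def)

lemma polyhedral_convex_set_solution_set:
  fixes H :: "(('a::locally_convex_hausdorff_space \<Rightarrow> real) \<times> real) set"
  assumes "finite H" "fst ` H \<subseteq> continuous_dual"
  shows "polyhedral_convex_set (solution_set H)"
proof -
  obtain h where h: "bij_betw h {1..card H} H"
    using assms(1) ex_bij_betw_nat_finite_1 by blast
  then have H: "H = h ` {1..card H}"
    by (simp add: bij_betw_def)
  have "solution_set H = {x. \<forall>i\<in>{1..card H}. fst (h i) x \<le> snd (h i)}"
    unfolding solution_set_def by (subst (1) H) (simp add: case_prod_unfold)
  moreover have "\<forall>i\<in>{1..card H}. fst (h i) \<in> continuous_dual"
    using assms(2) H by auto
  ultimately show ?thesis
    unfolding polyhedral_convex_set_def by fast
qed

lemma polyhedral_convex_setE: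
  fixes D :: "'a::locally_convex_hausdorff_space set"
  assumes "polyhedral_convex_set D"
  obtains H where "finite H" "fst ` H \<subseteq> continuous_dual" "D = solution_set H"
proof -
  obtain m :: nat and e :: "nat \<Rightarrow> 'a \<Rightarrow> real" and \<alpha> :: "nat \<Rightarrow> real"
    where e: "\<forall>i\<in>{1..m}. e i \<in> continuous_dual" "D = {x. \<forall>i\<in>{1..m}. e i x \<le> \<alpha> i}"
    using assms unfolding polyhedral_convex_set_def by blast
  show thesis
  proof (rule that)
    show "finite ((\<lambda>i. (e i, \<alpha> i)) ` {1..m})"
      by simp
    show "fst ` (\<lambda>i. (e i, \<alpha> i)) ` {1..m} \<subseteq> continuous_dual"
      using e(1) by auto
    show "D = solution_set ((\<lambda>i. (e i, \<alpha> i)) ` {1..m})"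
      by (simp add: e(2) solution_set_def)
  qed
qed

lemma polyhedral_convex_set_Int:
  fixes C D :: "'a::locally_convex_hausdorff_space set"
  assumes "polyhedral_convex_set C" "polyhedral_convex_set D"
  shows "polyhedral_convex_set (C \<inter> D)"
proof -
  obtain H where H: "finite H" "fst ` H \<subseteq> continuous_dual" "C = solution_set H"
    using assms(1) by (rule polyhedral_convex_setE)
  obtain K where K: "finite K" "fst ` K \<subseteq> continuous_dual" "D = solution_set K"
    using assms(2) by (rule polyhedral_convex_setE)
  have "C \<inter> D = solution_set (H \<union> K)"
    by (auto simp: H K solution_set_def)
  then show ?thesis
    using H K by (simp add: polyhedral_convex_set_solution_set image_Un)
qed

lemma polyhedral_convex_set_vimage:
  fixes T :: "'a::locally_convex_hausdorff_space \<Rightarrow> 'b::locally_convex_hausdorff_space"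
  assumes "linear T" "continuous_on UNIV T" "polyhedral_convex_set D"
  shows "polyhedral_convex_set (T -` D)"
proof -
  obtain H where H: "finite H" "fst ` H \<subseteq> continuous_dual" "D = solution_set H"
    using assms(3) by (rule polyhedral_convex_setE)
  define K where "K = (\<lambda>(f, a). (f \<circ> T, a)) ` H"
  have "f \<circ> T \<in> continuous_dual" if "f \<in> continuous_dual" for f :: "'b \<Rightarrow> real"
    using that assms(1,2) unfolding continuous_dual_def
    by (auto intro: linear_compose continuous_on_compose[OF assms(2)] continuous_on_subset
        simp del: o_apply)
  then have "fst ` K \<subseteq> continuous_dual"
    using H(2) by (force simp: K_def)
  moreover have "T -` D = solution_set K"
    by (simp add: set_eq_iff H(3) K_def mem_solution_set case_prod_unfold)
  ultimately show ?thesis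
    using H(1) by (simp add: K_def polyhedral_convex_set_solution_set)
qed

section \<open>Fourier--Motzkin elimination of one direction\<close>

lemma finite_real_sets_separation:
  fixes L U :: "real set"
  assumes "finite L" "finite U" "\<And>l u. l \<in> L \<Longrightarrow> u \<in> U \<Longrightarrow> l \<le> u"
  shows "\<exists>s. (\<forall>l\<in>L. l \<le> s) \<and> (\<forall>u\<in>U. s \<le> u)"
proof (cases "L = {}")
  case True
  then show ?thesis
    using assms(2) by (cases "U = {}") (auto intro: exI[of _ "Min U"])
next
  case False
  then show ?thesis
    using assms by (intro exI[of _ "Max L"]) auto
qed

lemma continuous_dual_linear_combination:
  assumes "f \<in> continuous_dual" "g \<in> continuous_dual"
  shows "(\<lambda>x. c * f x - d * g x) \<in> continuous_dual"
  using assms unfolding continuous_dual_def linear_iff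
  by (auto intro!: continuous_intros simp: algebra_simps)

text \<open>A point \<open>x\<close> lies in the sum if and only if some \<open>x + s v\<close> satisfies all the inequalities.
  The inequalities with \<open>f v = 0\<close> do not involve \<open>s\<close> and are kept.  As conditions on \<open>s\<close>,
  those with \<open>f v > 0\<close> are upper bounds and those with \<open>g v < 0\<close> are lower bounds; some \<open>s\<close>
  meets all of them if and only if no lower bound exceeds an upper bound.  Cleared of denominators, each comparison is again a continuous linear
  inequality in \<open>x\<close>.\<close>

lemma polyhedral_convex_set_plus_line:
  fixes v :: "'a::locally_convex_hausdorff_space"
  assumes "polyhedral_convex_set D"
  shows "polyhedral_convex_set (D + span {v})"
proof -
  obtain H where H: "finite H" "fst ` H \<subseteq> continuous_dual" "D = solution_set H"
    using assms by (rule polyhedral_convex_setE)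
  have lin: "linear f" if "(f, a) \<in> H" for f a
    using H(2) that by (force simp: continuous_dual_def)
  define Z where "Z = {(f, a)\<in>H. f v = 0}"
  define P where "P = {(f, a)\<in>H. f v > 0}"
  define N where "N = {(g, b)\<in>H. g v < 0}"
  define K where "K = Z \<union>
    (\<lambda>((f, a), (g, b)). (\<lambda>x. f v * g x - g v * f x, f v * b - g v * a)) ` (P \<times> N)"
  have fin: "finite Z" "finite P" "finite N"
    unfolding Z_def P_def N_def using H(1) by (auto intro: finite_subset[rotated])
  have "fst ` K \<subseteq> continuous_dual"
  proof -
    have "f \<in> continuous_dual" if "(f, a) \<in> H" for f a
      using H(2) that by force
    then show ?thesis
      by (auto simp: K_def Z_def P_def N_def intro!: continuous_dual_linear_combination)
  qed
  moreover have "D + span {v} = solution_set K"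
  proof (rule set_eqI)
    fix x
    have shift: "f (x + s *\<^sub>R v) = f x + s * f v" if "(f, a) \<in> H" for f a s
      using lin[OF that] by (simp add: linear_add linear_scale)
    have mem: "x \<in> D + span {v} \<longleftrightarrow> (\<exists>s. x + s *\<^sub>R v \<in> D)"
    proof
      assume "x \<in> D + span {v}"
      then obtain d t where "d \<in> D" "x = d + t *\<^sub>R v"
        by (auto simp: set_plus_def span_singleton)
      then have "x + (- t) *\<^sub>R v \<in> D"
        by simp
      then show "\<exists>s. x + s *\<^sub>R v \<in> D"
        by blast
    next
      assume "\<exists>s. x + s *\<^sub>R v \<in> D"
      then obtain s where s: "x + s *\<^sub>R v \<in> D"
        by blast
      have "x = (x + s *\<^sub>R v) + (- s) *\<^sub>R v" "(- s) *\<^sub>R v \<in> span {v}"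
        by (simp, simp only: span_base span_scale insertI1)
      then show "x \<in> D + span {v}"
        using s set_plus_intro by metis
    qed
    show "x \<in> D + span {v} \<longleftrightarrow> x \<in> solution_set K"
    proof
      assume "x \<in> D + span {v}"
      then obtain s where "x + s *\<^sub>R v \<in> D"
        using mem by blast
      then have s: "f x + s * f v \<le> a" if "(f, a) \<in> H" for f a
        using that shift[OF that, of s] by (force simp: H(3) mem_solution_set)
      have "f v * g x - g v * f x \<le> f v * b - g v * a"
        if "(f, a) \<in> H" "(g, b) \<in> H" "f v > 0" "g v < 0" for f a g b
      proof -
        have "f v * (g x + s * g v) \<le> f v * b" "- g v * (f x + s * f v) \<le> - g v * a"
          using that s by (auto intro!: mult_left_mono simp del: mult_minus_left)
        then show ?thesis
          by (simp add: algebra_simps)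
      qed
      moreover have "f x \<le> a" if "(f, a) \<in> H" "f v = 0" for f a
        using s[OF that(1)] that(2) by simp
      ultimately show "x \<in> solution_set K"
        by (auto simp: mem_solution_set K_def Z_def P_def N_def)
    next
      assume "x \<in> solution_set K"
      then have zero: "f x \<le> a" if "(f, a) \<in> Z" for f a
        using that by (force simp: mem_solution_set K_def)
      have pair: "f v * g x - g v * f x \<le> f v * b - g v * a" if "(f, a) \<in> P" "(g, b) \<in> N" for f a g b
      proof -
        have "(\<lambda>x. f v * g x - g v * f x, f v * b - g v * a) \<in> K"
          unfolding K_def by (rule UnI2, rule image_eqI[of _ _ "((f, a), (g, b))"]) (simp_all add: that)
        then show ?thesis
          using \<open>x \<in> solution_set K\<close> unfolding mem_solution_set by (metis (no_types, lifting) case_prodD)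
      qed
      define bound where "bound = (\<lambda>(f, a). (a - f x) / f v :: real)"
      have "\<exists>s. (\<forall>l\<in>bound ` N. l \<le> s) \<and> (\<forall>u\<in>bound ` P. s \<le> u)"
      proof (rule finite_real_sets_separation)
        fix l u
        assume "l \<in> bound ` N" "u \<in> bound ` P"
        then obtain f a g b where fg: "(f, a) \<in> P" "(g, b) \<in> N"
          and lu: "l = (b - g x) / g v" "u = (a - f x) / f v"
          by (auto simp: bound_def)
        have "f v > 0" "g v < 0"
          using fg by (auto simp: P_def N_def)
        moreover from this have "f v * (b - g x) \<ge> g v * (a - f x)"
          using pair[OF fg] by (simp add: algebra_simps)
        ultimately show "l \<le> u"
          by (simp add: lu divide_simps mult.commute)
      qed (use fin in auto)
      then obtain s where s: "\<And>h. h \<in> N \<Longrightarrow> bound h \<le> s" "\<And>h. h \<in> P \<Longrightarrow> s \<le> bound h"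
        by auto
      have "f (x + s *\<^sub>R v) \<le> a" if fa: "(f, a) \<in> H" for f a
      proof -
        consider "f v = 0" | "f v > 0" | "f v < 0"
          by linarith
        then show ?thesis
        proof cases
          case 1
          then show ?thesis
            using zero[of f a] fa shift[OF fa, of s] by (simp add: Z_def)
        next
          case 2
          then have "s \<le> (a - f x) / f v"
            using s(2)[of "(f, a)"] fa by (simp add: P_def bound_def)
          then show ?thesis
            using 2 shift[OF fa, of s] by (simp add: pos_le_divide_eq)
        next
          case 3
          then have "(a - f x) / f v \<le> s"
            using s(1)[of "(f, a)"] fa by (simp add: N_def bound_def)
          then show ?thesis
            using 3 shift[OF fa, of s] by (simp add: neg_divide_le_eq)
        qed
      qed
      then have "x + s *\<^sub>R v \<in> D"
        by (auto simp: H(3) mem_solution_set)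
      then show "x \<in> D + span {v}"
        using mem by blast
    qed
  qed
  ultimately show ?thesis
    using fin by (simp add: K_def polyhedral_convex_set_solution_set)
qed

section \<open>Adding a linear subspace\<close>

text \<open>The kernel has codimension one in \<open>W\<close>: subtracting the multiple \<open>(f w / f v) v\<close> moves \<open>w\<close>
  into it.\<close>

lemma subspace_eq_kernel_plus_line:
  fixes f :: "'a::real_vector \<Rightarrow> real"
  assumes "subspace W" "linear f" "v \<in> W" "f v \<noteq> 0"
  shows "W = (W \<inter> {w. f w = 0}) + span {v}"
proof (rule set_eqI)
  fix w
  show "w \<in> W \<longleftrightarrow> w \<in> (W \<inter> {w. f w = 0}) + span {v}"
  proof
    assume w: "w \<in> W"
    let ?t = "f w / f v"
    have "w - ?t *\<^sub>R v \<in> W \<inter> {w. f w = 0}"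
      using w assms by (simp add: subspace_diff subspace_scale linear_diff linear_scale)
    moreover have "?t *\<^sub>R v \<in> span {v}"
      by (simp add: span_base span_scale)
    ultimately have "(w - ?t *\<^sub>R v) + ?t *\<^sub>R v \<in> (W \<inter> {w. f w = 0}) + span {v}"
      by (rule set_plus_intro)
    then show "w \<in> (W \<inter> {w. f w = 0}) + span {v}"
      by simp
  next
    assume "w \<in> (W \<inter> {w. f w = 0}) + span {v}"
    then show "w \<in> W"
      using assms(1,3) by (auto simp: set_plus_def span_singleton subspace_add subspace_scale)
  qed
qed

text \<open>Induction on the set \<open>J\<close> of inequalities whose functional may be nonzero on \<open>W\<close>.  If none is,
  adding \<open>W\<close> changes nothing.  Otherwise \<open>W\<close> is the sum of a line and a kernel
  \<open>W'\<close> in \<open>W\<close>.  The order matters: \<open>W'\<close> is added to \<open>D\<close> first, because it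
  is the original system defining \<open>D\<close> that has fewer nonvanishing functionals on \<open>W'\<close>, whereas
  eliminating the line first would create new inequalities and destroy that measure.\<close>

lemma polyhedral_convex_set_plus_subspace:
  fixes D W :: "'a::locally_convex_hausdorff_space set"
  assumes "polyhedral_convex_set D" "subspace W"
  shows "polyhedral_convex_set (D + W)"
proof -
  obtain H where H: "finite H" "fst ` H \<subseteq> continuous_dual" "D = solution_set H"
    using assms(1) by (rule polyhedral_convex_setE)
  have lin: "linear f" if "(f, a) \<in> H" for f a
    using H(2) that by (force simp: continuous_dual_def)
  have "polyhedral_convex_set (D + W)"
    if "finite J" "J \<subseteq> H" "subspace W" "\<And>f a w. (f, a) \<in> H - J \<Longrightarrow> w \<in> W \<Longrightarrow> f w = 0" for J W
    using that
  proof (induction J arbitrary: W rule: finite_induct)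
    case empty
    have "d + w \<in> D" if "d \<in> D" "w \<in> W" for d w
    proof -
      have "f (d + w) \<le> a" if fa: "(f, a) \<in> H" for f a
      proof -
        have "f (d + w) = f d"
          using lin[OF fa] empty.prems(3)[of f a w] fa \<open>w \<in> W\<close> by (simp add: linear_add)
        moreover have "f d \<le> a"
          using \<open>d \<in> D\<close> fa by (auto simp: H(3) mem_solution_set)
        ultimately show ?thesis
          by simp
      qed
      then show ?thesis
        by (auto simp: H(3) mem_solution_set)
    qed
    moreover have "d \<in> D + W" if "d \<in> D" for d
      using set_plus_intro[OF that subspace_0[OF empty.prems(2)]] by simp
    ultimately have "D + W = D"
      by (auto elim!: set_plus_elim)
    then show ?case
      using assms(1) by simp
  next
    case (insert h J)
    obtain f a where h: "h = (f, a)"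
      by (cases h)
    then have f: "linear f"
      using insert.prems(1) lin by auto
    let ?W' = "W \<inter> {w. f w = 0}"
    have "subspace {w. f w = 0}"
      using f by (rule linear_subspace_kernel)
    then have W': "polyhedral_convex_set (D + ?W')"
      using insert.prems h by (intro insert.IH) (auto intro: subspace_inter)
    show ?case
    proof (cases "\<exists>v\<in>W. f v \<noteq> 0")
      case True
      then obtain v where "v \<in> W" "f v \<noteq> 0"
        by blast
      then have "D + W = (D + ?W') + span {v}"
        using subspace_eq_kernel_plus_line[OF insert.prems(2) f] by (metis add.assoc)
      then show ?thesis
        using polyhedral_convex_set_plus_line[OF W'] by simp
    next
      case False
      then have "?W' = W"
        by auto
      then show ?thesis
        using W' by simp
    qed
  qed
  from this[of H W] show ?thesis
    using H(1) assms(2) by simp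
qed

text \<open>Projecting along the second factor amounts to adding \<open>{0} \<times> Y\<close> and then
  intersecting with the slice of all points \<open>(p, 0)\<close>.\<close>

lemma polyhedral_convex_set_fst_image:
  fixes P :: "('a::locally_convex_hausdorff_space \<times> 'b::locally_convex_hausdorff_space) set"
  assumes "polyhedral_convex_set P"
  shows "polyhedral_convex_set (fst ` P)"
proof -
  let ?W = "{0} \<times> UNIV :: ('a \<times> 'b) set"
  have "fst ` P = (\<lambda>p. (p, 0)) -` (P + ?W)"
  proof (intro set_eqI iffI)
    fix p
    assume "p \<in> fst ` P"
    then obtain z where "(p, z) \<in> P"
      by auto
    then have "(p, z) + (0, - z) \<in> P + ?W"
      by (intro set_plus_intro) auto
    then show "p \<in> (\<lambda>p. (p, 0)) -` (P + ?W)"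
      by simp
  next
    fix p
    assume "p \<in> (\<lambda>p. (p, 0)) -` (P + ?W)"
    then show "p \<in> fst ` P"
      by (force elim!: set_plus_elim)
  qed
  moreover have "polyhedral_convex_set (P + ?W)"
    using assms by (rule polyhedral_convex_set_plus_subspace) (auto simp: subspace_def zero_prod_def)
  moreover have "linear (\<lambda>p::'a. (p, 0::'b))"
    by (simp add: linear_iff)
  moreover have "continuous_on UNIV (\<lambda>p::'a. (p, 0::'b))"
    by (intro continuous_intros)
  ultimately show ?thesis
    by (simp add: polyhedral_convex_set_vimage)
qed

section \<open>Sums of polyhedral convex multifunctions\<close>

theorem theorem4p3:
  fixes F1 F2 :: "'x::locally_convex_hausdorff_space \<Rightarrow> 'y::locally_convex_hausdorff_space set"
  assumes "polyhedral_convex_multifunction F1"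
    and "polyhedral_convex_multifunction F2"
  shows "polyhedral_convex_multifunction (multifunction_sum F1 F2)"
proof -
  define T1 :: "('x \<times> 'y) \<times> 'y \<Rightarrow> 'x \<times> 'y" where "T1 = (\<lambda>q. (fst (fst q), snd q))"
  define T2 :: "('x \<times> 'y) \<times> 'y \<Rightarrow> 'x \<times> 'y" where "T2 = (\<lambda>q. (fst (fst q), snd (fst q) - snd q))"
  have "linear T1" "linear T2"
    by (auto simp: T1_def T2_def linear_iff algebra_simps)
  moreover have "continuous_on UNIV T1" "continuous_on UNIV T2"
    unfolding T1_def T2_def by (intro continuous_intros)+
  ultimately have "polyhedral_convex_set (T1 -` gph F1 \<inter> T2 -` gph F2)"
    using assms unfolding polyhedral_convex_multifunction_def
    by (intro polyhedral_convex_set_Int polyhedral_convex_set_vimage)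
  then have "polyhedral_convex_set (fst ` (T1 -` gph F1 \<inter> T2 -` gph F2))"
    by (rule polyhedral_convex_set_fst_image)
  moreover have "fst ` (T1 -` gph F1 \<inter> T2 -` gph F2) = gph (multifunction_sum F1 F2)"
  proof (intro set_eqI iffI)
    fix p
    assume "p \<in> fst ` (T1 -` gph F1 \<inter> T2 -` gph F2)"
    then obtain x y z where p: "p = (x, y)" and "z \<in> F1 x" "y - z \<in> F2 x"
      by (auto simp: T1_def T2_def gph_def)
    then have "z + (y - z) \<in> F1 x + F2 x"
      by (intro set_plus_intro)
    then show "p \<in> gph (multifunction_sum F1 F2)"
      by (simp add: p gph_def multifunction_sum_def)
  next
    fix p
    assume "p \<in> gph (multifunction_sum F1 F2)"
    then obtain x y z where "p = (x, z + y)" "z \<in> F1 x" "y \<in> F2 x"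
      by (auto simp: gph_def multifunction_sum_def elim!: set_plus_elim)
    then show "p \<in> fst ` (T1 -` gph F1 \<inter> T2 -` gph F2)"
      by (intro image_eqI[of _ _ "(p, z)"]) (auto simp: T1_def T2_def gph_def)
  qed
  ultimately show ?thesis
    unfolding polyhedral_convex_multifunction_def by simp
qed

end
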